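(* The complex $\Delta=\Delta(L)$ gets the structure of a differential graded algebra via the bilinear multiplication defined on basis elements (sets $\sigma,\tau$ of atoms of $L$) by $$\sigma\cdot\tau=\begin{cases}0 & \text{if } \operatorname{rk}\big(\bigvee(\sigma\cup\tau)\big)\neq\operatorname{rk}\big(\bigvee(\sigma)\big)+\operatorname{rk}\big(\bigvee(\tau)\big),\\ (-1)^{\epsilon(\sigma,\tau)}\,\sigma\cup\tau & \text{otherwise,}\end{cases}$$ where $\epsilon(\sigma,\tau)$ is the parity of the permutation of $\sigma\cup\tau$ (shuffle) putting all elements of $\tau$ after the elements of $\sigma$ and preserving the fixed orders inside these sets.
   Context: Let $L$ be a finite lattice with minimal element $\hat 0$, whose atoms $Z_1,Z_2,\dots$ are provided with a fixed linear ordering (by index). $L$ is graded: there is given a map $\operatorname{rk}:L\to\mathbb N^s$ (for some positive integer $s$; $\mathbb N^s$ with the componentwise order) which is strictly monotone, with $\operatorname{rk}(\hat0)=0$ and $\operatorname{rk}(X\vee Y)+\operatorname{rk}(X\wedge Y)\le\operatorname{rk}(X)+\operatorname{rk}(Y)$ for all $X,Y\in L$. $\bigvee(\sigma)$ denotes the join of $\sigma\subset L$ ($\bigvee(\emptyset)=\hat0$). The relative atomic complex $\Delta=\Delta(L)$ (over a field or over $\mathbb Z$) has $p$-th term $\Delta_p$ the free module with basis all sets $\sigma$ of atoms of $L$ with $|\sigma|=p$, and differential $d:\Delta_p\to\Delta_{p-1}$ $$d\sigma=\sum_{Z_i\in\sigma,\ \bigvee(\sigma_i)=\bigvee(\sigma)}(-1)^{\epsilon(\sigma,i)}\sigma_i,$$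 where $\sigma_i=\sigma\setminus\{Z_i\}$ and $\epsilon(\sigma,i)=|\{Z_j\in\sigma: j<i\}|$. The DGA structure means: associative, graded by $|\sigma|$, and satisfying the Leibniz rule $d(\sigma\cdot\tau)=d(\sigma)\cdot\tau+(-1)^{|\sigma|}\sigma\cdot d(\tau)$. *)

theory Defs
  imports
    "HOL-Analysis.Finite_Cartesian_Product"
    "HOL-Combinatorics.Permutations"
    "HOL-Library.Poly_Mapping"
begin

text \<open>
  The underlying module is a subset \<open>C\<close> of a module type, and \<open>A p\<close> is its homogeneous part of
  degree \<open>p\<close>. The differential has degree \<open>- 1\<close>; the parts of negative degree are zero.
  No unit element is required.
\<close>

locale differential_graded_algebra = module scale
  for scale :: "'k::comm_ring_1 \<Rightarrow> 'm::ab_group_add \<Rightarrow> 'm" +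
  fixes C :: "'m set"
    and A :: "nat \<Rightarrow> 'm set"
    and d :: "'m \<Rightarrow> 'm"
    and mult :: "'m \<Rightarrow> 'm \<Rightarrow> 'm"
  assumes subspace_C: "subspace C"
    and subspace_A: "subspace (A p)"
    and A_subset: "A p \<subseteq> C"
    and direct_sum: "x \<in> C \<Longrightarrow>
      \<exists>!f. (\<forall>p. f p \<in> A p) \<and> finite {p. f p \<noteq> 0} \<and> x = (\<Sum>p | f p \<noteq> 0. f p)"
    and d_add: "\<lbrakk>x \<in> C; y \<in> C\<rbrakk> \<Longrightarrow> d (x + y) = d x + d y"
    and d_scale: "x \<in> C \<Longrightarrow> d (scale a x) = scale a (d x)"
    and d_degree_0: "x \<in> A 0 \<Longrightarrow> d x = 0"
    and d_degree: "x \<in> A (Suc p) \<Longrightarrow> d x \<in> A p"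
    and d_d: "x \<in> C \<Longrightarrow> d (d x) = 0"
    and mult_add_left: "\<lbrakk>x \<in> C; y \<in> C; z \<in> C\<rbrakk> \<Longrightarrow> mult (x + y) z = mult x z + mult y z"
    and mult_add_right: "\<lbrakk>x \<in> C; y \<in> C; z \<in> C\<rbrakk> \<Longrightarrow> mult x (y + z) = mult x y + mult x z"
    and mult_scale_left: "\<lbrakk>x \<in> C; y \<in> C\<rbrakk> \<Longrightarrow> mult (scale a x) y = scale a (mult x y)"
    and mult_scale_right: "\<lbrakk>x \<in> C; y \<in> C\<rbrakk> \<Longrightarrow> mult x (scale a y) = scale a (mult x y)"
    and mult_degree: "\<lbrakk>x \<in> A p; y \<in> A q\<rbrakk> \<Longrightarrow> mult x y \<in> A (p + q)"
    and mult_assoc: "\<lbrakk>x \<in> C; y \<in> C; z \<in> C\<rbrakk> \<Longrightarrow> mult (mult x y) z = mult x (mult y z)"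
    and leibniz: "\<lbrakk>x \<in> A p; y \<in> C\<rbrakk> \<Longrightarrow>
      d (mult x y) = mult (d x) y + scale ((- 1) ^ p) (mult x (d y))"

text \<open>The free module on a type of basis elements is the type of finitely supported functions.\<close>

definition free_scale :: "'k::comm_ring_1 \<Rightarrow> ('b \<Rightarrow>\<^sub>0 'k) \<Rightarrow> ('b \<Rightarrow>\<^sub>0 'k)" where
  "free_scale a = Poly_Mapping.map ((*) a)"

definition lin_extend :: "('b \<Rightarrow> ('c \<Rightarrow>\<^sub>0 'k::comm_ring_1)) \<Rightarrow> ('b \<Rightarrow>\<^sub>0 'k) \<Rightarrow> ('c \<Rightarrow>\<^sub>0 'k)" where
  "lin_extend f x = (\<Sum>b\<in>Poly_Mapping.keys x. free_scale (Poly_Mapping.lookup x b) (f b))"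

definition atoms :: "'l::order_bot set" where
  "atoms = {z. bot < z \<and> (\<forall>x. x < z \<longrightarrow> x = bot)}"

text \<open>
  The fixed order of the atoms is given by a function \<open>ix\<close>, injective on the atoms, that
  returns the index of an atom.
\<close>

definition rel_atomic :: "('l::{finite,complete_lattice} set \<Rightarrow>\<^sub>0 'k::comm_ring_1) set" where
  "rel_atomic = {x. \<forall>\<sigma>\<in>Poly_Mapping.keys x. \<sigma> \<subseteq> atoms}"

definition rel_atomic_part ::
  "nat \<Rightarrow> ('l::{finite,complete_lattice} set \<Rightarrow>\<^sub>0 'k::comm_ring_1) set" where
  "rel_atomic_part p = {x. \<forall>\<sigma>\<in>Poly_Mapping.keys x. \<sigma> \<subseteq> atoms \<and> card \<sigma> = p}"

definition eps :: "('l \<Rightarrow> nat) \<Rightarrow> 'l set \<Rightarrow> 'l \<Rightarrow> nat" where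
  "eps ix \<sigma> z = card {w \<in> \<sigma>. ix w < ix z}"

definition rel_atomic_diff :: "('l::{finite,complete_lattice} \<Rightarrow> nat) \<Rightarrow>
    ('l set \<Rightarrow>\<^sub>0 'k::comm_ring_1) \<Rightarrow> ('l set \<Rightarrow>\<^sub>0 'k)" where
  "rel_atomic_diff ix = lin_extend (\<lambda>\<sigma>.
     \<Sum>z | z \<in> \<sigma> \<and> Sup (\<sigma> - {z}) = Sup \<sigma>. Poly_Mapping.single (\<sigma> - {z}) ((- 1) ^ eps ix \<sigma> z))"

text \<open>
  For disjoint \<open>\<sigma>\<close> and \<open>\<tau>\<close>, the shuffle permutation sends the \<open>k\<close>-th element of \<open>\<sigma> \<union> \<tau>\<close> in
  increasing order to the \<open>k\<close>-th entry of the list of the elements of \<open>\<sigma>\<close> in increasing order,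
  followed by those of \<open>\<tau>\<close> in increasing order; it fixes everything outside \<open>\<sigma> \<union> \<tau>\<close>.
  If \<open>\<sigma>\<close> and \<open>\<tau>\<close> share an atom, then submodularity of the rank puts them in the zero case of the
  product, so the value used for overlapping sets is irrelevant.
\<close>

definition shuffle_perm :: "('l \<Rightarrow> nat) \<Rightarrow> 'l set \<Rightarrow> 'l set \<Rightarrow> 'l \<Rightarrow> 'l" where
  "shuffle_perm ix \<sigma> \<tau> = permutation_of_list
     (zip (sorted_key_list_of_set ix (\<sigma> \<union> \<tau>))
          (sorted_key_list_of_set ix \<sigma> @ sorted_key_list_of_set ix \<tau>))"

definition shuffle_parity :: "('l \<Rightarrow> nat) \<Rightarrow> 'l set \<Rightarrow> 'l set \<Rightarrow> nat" where
  "shuffle_parity ix \<sigma> \<tau> = (if evenperm (shuffle_perm ix \<sigma> \<tau>) then 0 else 1)"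

definition rel_atomic_mult ::
  "('l::{finite,complete_lattice} \<Rightarrow> nat) \<Rightarrow> ('l \<Rightarrow> nat ^ 's) \<Rightarrow>
    ('l set \<Rightarrow>\<^sub>0 'k::comm_ring_1) \<Rightarrow> ('l set \<Rightarrow>\<^sub>0 'k) \<Rightarrow> ('l set \<Rightarrow>\<^sub>0 'k)" where
  "rel_atomic_mult ix rk x y = lin_extend (\<lambda>\<sigma>. lin_extend (\<lambda>\<tau>.
     if rk (Sup (\<sigma> \<union> \<tau>)) \<noteq> rk (Sup \<sigma>) + rk (Sup \<tau>) then 0
     else Poly_Mapping.single (\<sigma> \<union> \<tau>) ((- 1) ^ shuffle_parity ix \<sigma> \<tau>)) y) x"

end

theory Submission
  imports Defs
begin

text \<open>
  By bilinearity all identities reduce to basis elements. There the sign of the shuffle is \<open>- 1\<close> to the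
  number of inversions between \<open>\<sigma>\<close> and \<open>\<tau>\<close>, which is additive in both arguments. The nonzero
  products are governed by subadditivity of the rank on joins: \<open>\<sigma> \<cdot> \<tau> \<cdot> \<rho>\<close> is nonzero, for either
  bracketing, iff the rank of the join of all three is the sum of the three ranks. If
  \<open>\<sigma> \<cdot> \<tau> \<noteq> 0\<close>, then removing an atom of \<open>\<sigma>\<close> preserves \<open>\<Squnion>(\<sigma> \<union> \<tau>)\<close> iff it preserves \<open>\<Squnion>\<sigma>\<close>, which
  matches the terms in the Leibniz rule.
\<close>

section \<open>Linear extension\<close>

lemma lookup_free_scale [simp]:
  "Poly_Mapping.lookup (free_scale a x) b = a * Poly_Mapping.lookup x b"
  by (simp add: free_scale_def Poly_Mapping.map.rep_eq when_def)

lemma keys_free_scale: "Poly_Mapping.keys (free_scale a x) \<subseteq> Poly_Mapping.keys x"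
  by (auto simp: in_keys_iff)

lemma module_free_scale: "module free_scale"
  by standard (auto intro!: poly_mapping_eqI simp: lookup_add algebra_simps)

lemma free_scale_zero [simp]: "free_scale a 0 = 0"
  by (rule poly_mapping_eqI) simp

lemma free_scale_single [simp]:
  "free_scale a (Poly_Mapping.single b c) = Poly_Mapping.single b (a * c)"
  by (rule poly_mapping_eqI) (simp add: lookup_single when_def)

text \<open>An arbitrary finite \<open>B\<close> around the support lets vectors with different
  supports be compared over one index set.\<close>

lemma lookup_lin_extend:
  assumes "finite B" "Poly_Mapping.keys x \<subseteq> B"
  shows "Poly_Mapping.lookup (lin_extend f x) c =
    (\<Sum>b\<in>B. Poly_Mapping.lookup x b * Poly_Mapping.lookup (f b) c)"
  unfolding lin_extend_def lookup_sum lookup_free_scale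
  using assms by (intro sum.mono_neutral_left) (auto simp: in_keys_iff)

lemma lin_extend_zero [simp]: "lin_extend f 0 = 0"
  by (simp add: lin_extend_def)

lemma lin_extend_single [simp]:
  "lin_extend f (Poly_Mapping.single b a) = free_scale a (f b)"
  by (rule poly_mapping_eqI) (simp add: lookup_lin_extend[of "{b}"])

lemma lin_extend_add: "lin_extend f (x + y) = lin_extend f x + lin_extend f y"
proof (rule poly_mapping_eqI)
  fix c
  let ?B = "Poly_Mapping.keys x \<union> Poly_Mapping.keys y"
  show "Poly_Mapping.lookup (lin_extend f (x + y)) c =
      Poly_Mapping.lookup (lin_extend f x + lin_extend f y) c"
    using Poly_Mapping.keys_add[of x y]
    by (simp add: lookup_lin_extend[of ?B] lookup_add sum.distrib distrib_right)
qed

lemma lin_extend_scale: "lin_extend f (free_scale a x) = free_scale a (lin_extend f x)"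
  using keys_free_scale[of a x]
  by (intro poly_mapping_eqI)
    (simp add: lookup_lin_extend[of "Poly_Mapping.keys x"] sum_distrib_left mult.assoc)

lemma lin_extend_sum: "lin_extend f (\<Sum>i\<in>I. g i) = (\<Sum>i\<in>I. lin_extend f (g i))"
  by (induction I rule: infinite_finite_induct) (auto simp: lin_extend_add)

lemma lin_extend_add_fun: "lin_extend (\<lambda>b. f b + g b) x = lin_extend f x + lin_extend g x"
  by (rule poly_mapping_eqI)
    (simp add: lookup_lin_extend[of "Poly_Mapping.keys x"] lookup_add sum.distrib distrib_left)

lemma lin_extend_scale_fun:
  "lin_extend (\<lambda>b. free_scale a (f b)) x = free_scale a (lin_extend f x)"
  by (rule poly_mapping_eqI)
    (simp add: lookup_lin_extend[of "Poly_Mapping.keys x"] sum_distrib_left mult.left_commute)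

lemma lin_extend_zero_fun [simp]: "lin_extend (\<lambda>b. 0) x = 0"
  by (rule poly_mapping_eqI) (simp add: lookup_lin_extend[of "Poly_Mapping.keys x"])

text \<open>With this and \<open>lin_extend_swap\<close>, identities of the algebra become
  equalities of iterated extensions, where \<open>lin_extend_cong\<close> leaves only basis elements
  to check.\<close>

lemma lin_extend_comp: "lin_extend f (lin_extend g x) = lin_extend (\<lambda>b. lin_extend f (g b)) x"
  by (simp add: lin_extend_def[of g] lin_extend_sum lin_extend_scale)
    (simp add: lin_extend_def[of _ x])

lemma lin_extend_swap:
  "lin_extend (\<lambda>b. lin_extend (f b) y) x = lin_extend (\<lambda>c. lin_extend (\<lambda>b. f b c) x) y"
proof (rule poly_mapping_eqI)
  fix e
  show "Poly_Mapping.lookup (lin_extend (\<lambda>b. lin_extend (f b) y) x) e =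
      Poly_Mapping.lookup (lin_extend (\<lambda>c. lin_extend (\<lambda>b. f b c) x) y) e"
    by (simp add: lookup_lin_extend[of "Poly_Mapping.keys x" x]
      lookup_lin_extend[of "Poly_Mapping.keys y" y] sum_distrib_left)
      (subst sum.swap, simp add: mult.left_commute)
qed

lemma lin_extend_cong:
  "(\<And>b. b \<in> Poly_Mapping.keys x \<Longrightarrow> f b = g b) \<Longrightarrow> lin_extend f x = lin_extend g x"
  unfolding lin_extend_def by (rule sum.cong) auto

lemma keys_lin_extend:
  assumes "c \<in> Poly_Mapping.keys (lin_extend f x)"
  shows "\<exists>b\<in>Poly_Mapping.keys x. c \<in> Poly_Mapping.keys (f b)"
proof -
  have "(\<Sum>b\<in>Poly_Mapping.keys x. Poly_Mapping.lookup x b * Poly_Mapping.lookup (f b) c) \<noteq> 0"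
    using assms by (simp add: in_keys_iff lookup_lin_extend[of "Poly_Mapping.keys x"])
  then obtain b where "b \<in> Poly_Mapping.keys x"
    and "Poly_Mapping.lookup x b * Poly_Mapping.lookup (f b) c \<noteq> 0"
    by (rule sum.not_neutral_contains_not_neutral)
  then show ?thesis
    by (intro bexI[of _ b]) (auto simp: in_keys_iff)
qed

section \<open>The sign of a shuffle\<close>

text \<open>Outside its first list \<open>permutation_of_list\<close> is the identity by default; at
  such a point the equation needs \<open>f\<close> to fix it.\<close>

lemma permutation_of_list_zip_map:
  assumes "length xs = length ys" "x \<in> set xs \<or> f x = x"
  shows "permutation_of_list (zip xs (map f ys)) x = f (permutation_of_list (zip xs ys) x)"
  using assms by (induction xs ys rule: list_induct2) (auto simp: permutation_of_list_Cons)

lemma permutation_permutation_of_list_zip: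
  assumes "distinct xs" "distinct ys" "set xs = set ys"
  shows "permutation (permutation_of_list (zip xs ys))"
proof -
  have "length xs = length ys"
    using assms by (metis distinct_card)
  then have "permutation_of_list (zip xs ys) permutes set xs"
    using assms by (intro permutation_of_list_permutes list_permutesI) auto
  then show ?thesis
    by (rule permutes_imp_permutation[rotated]) simp
qed

text \<open>Applying \<open>transpose a b\<close> to the values exchanges the two entries and fixes
  \<open>us\<close> and \<open>vs\<close>, so the two permutations differ by composition with a
  transposition.\<close>

lemma sign_permutation_of_list_swap:
  assumes "distinct xs" "distinct (us @ a # b # vs)" "set xs = set (us @ a # b # vs)"
  shows "sign (permutation_of_list (zip xs (us @ a # b # vs))) =
    - sign (permutation_of_list (zip xs (us @ b # a # vs)))"
proof -
  let ?t = "transpose a b"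
  have "map ?t us = us" "map ?t vs = vs"
    using assms(2) by (auto intro!: map_idI simp: transpose_def)
  then have m: "us @ a # b # vs = map ?t (us @ b # a # vs)"
    by simp
  have len: "length xs = length (us @ b # a # vs)"
    using assms distinct_card[of xs] distinct_card[of "us @ a # b # vs"] by simp
  have "permutation_of_list (zip xs (us @ a # b # vs)) =
      ?t \<circ> permutation_of_list (zip xs (us @ b # a # vs))"
    unfolding m using assms(3)
    by (intro ext, subst permutation_of_list_zip_map[OF len])
      (auto simp: transpose_def)
  moreover have "permutation (permutation_of_list (zip xs (us @ b # a # vs)))"
    using assms by (intro permutation_permutation_of_list_zip) auto
  ultimately show ?thesis
    using assms(2) by (simp add: sign_compose permutation_swap_id sign_swap_id)
qed

text \<open>The entry \<open>m\<close> passes the entries of \<open>ss\<close> one at a time, and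
  each adjacent swap contributes a factor -1.\<close>

lemma sign_permutation_of_list_move:
  assumes "distinct xs" "distinct (us @ ss @ m # vs)" "set xs = set (us @ ss @ m # vs)"
  shows "sign (permutation_of_list (zip xs (us @ ss @ m # vs))) =
    (- 1) ^ length ss * sign (permutation_of_list (zip xs (us @ m # ss @ vs)))"
  using assms
proof (induction ss arbitrary: us)
  case (Cons a ss)
  \<comment> \<open>The head \<open>a\<close> joins the prefix, so the induction hypothesis brings
    \<open>m\<close> next to \<open>a\<close>; one further swap moves it past
    \<open>a\<close>.\<close>
  have "sign (permutation_of_list (zip xs ((us @ [a]) @ ss @ m # vs))) =
      (- 1) ^ length ss * sign (permutation_of_list (zip xs ((us @ [a]) @ m # ss @ vs)))"
    using Cons.prems by (intro Cons.IH) auto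
  also have "sign (permutation_of_list (zip xs ((us @ [a]) @ m # ss @ vs))) =
      - sign (permutation_of_list (zip xs (us @ m # a # ss @ vs)))"
    using Cons.prems sign_permutation_of_list_swap[of xs us a m "ss @ vs"] by auto
  finally show ?case by simp
qed simp

text \<open>The pairs of \<open>s\<close> in \<sigma> and \<open>t\<close> in \<tau> with
  \<open>t\<close> before \<open>s\<close>, grouped by \<open>s\<close>. Writing the count through
  \<open>eps\<close> lets it combine with the signs of the differential.\<close>

definition inversions :: "('l \<Rightarrow> nat) \<Rightarrow> 'l set \<Rightarrow> 'l set \<Rightarrow> nat" where
  "inversions ix \<sigma> \<tau> = (\<Sum>s\<in>\<sigma>. eps ix \<tau> s)"

lemma eps_Un:
  "finite \<sigma> \<Longrightarrow> finite \<tau> \<Longrightarrow> \<sigma> \<inter> \<tau> = {} \<Longrightarrow> eps ix (\<sigma> \<union> \<tau>) z = eps ix \<sigma> z + eps ix \<tau> z"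
  unfolding eps_def by (subst card_Un_disjoint[symmetric]) (auto intro!: arg_cong[of _ _ card])

lemma inversions_Un_left:
  "finite \<sigma> \<Longrightarrow> finite \<tau> \<Longrightarrow> \<sigma> \<inter> \<tau> = {} \<Longrightarrow>
    inversions ix (\<sigma> \<union> \<tau>) \<rho> = inversions ix \<sigma> \<rho> + inversions ix \<tau> \<rho>"
  unfolding inversions_def by (rule sum.union_disjoint)

lemma inversions_Un_right:
  "finite \<tau> \<Longrightarrow> finite \<rho> \<Longrightarrow> \<tau> \<inter> \<rho> = {} \<Longrightarrow>
    inversions ix \<sigma> (\<tau> \<union> \<rho>) = inversions ix \<sigma> \<tau> + inversions ix \<sigma> \<rho>"
  by (simp add: inversions_def eps_Un sum.distrib)

text \<open>Induction on the merged list. Its least element \<open>m\<close> heads \<open>ss\<close>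
  or \<open>ts\<close>. In the first case it takes part in no inversion and is dropped; in the
  second it must be moved across all of \<open>ss\<close>, with each of whose entries it forms an
  inversion.\<close>

lemma sign_permutation_of_list_shuffle:
  assumes "sorted_wrt (<) (map ix xs)" "sorted_wrt (<) (map ix ss)" "sorted_wrt (<) (map ix ts)"
    and "set xs = set ss \<union> set ts" "set ss \<inter> set ts = {}"
  shows "sign (permutation_of_list (zip xs (ss @ ts))) = (- 1) ^ inversions ix (set ss) (set ts)"
  using assms
proof (induction xs arbitrary: ss ts)
  case Nil
  then show ?case by (simp add: inversions_def permutation_of_list_def[abs_def] sign_id[unfolded id_def])
next
  case (Cons m xs)
  have dist: "distinct ys" if "sorted_wrt (<) (map ix ys)" for ys :: "'a list"
    using that by (simp add: strict_sorted_iff distinct_map)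
  have m: "ix m < ix x" if "x \<in> set xs" for x
    using Cons.prems(1) that by simp
  then have mxs: "m \<notin> set xs" by blast
  have hd: "\<exists>ys'. ys = m # ys'"
    if "sorted_wrt (<) (map ix ys)" "m \<in> set ys" "set ys \<subseteq> set (m # xs)" for ys
    using that m by (cases ys) (auto dest: less_asym)
  \<comment> \<open>Matching \<open>m\<close> with itself changes nothing, because \<open>m\<close>
    is not in \<open>xs\<close> and the shorter list fixes it by default.\<close>
  have fix_m: "permutation_of_list ((m, m) # zip xs ys) = permutation_of_list (zip xs ys)" for ys
  proof
    fix x
    have "permutation_of_list (zip xs ys) m = m"
      using mxs by (intro permutation_of_list_id) (auto dest: set_zip_leftD)
    then show "permutation_of_list ((m, m) # zip xs ys) x = permutation_of_list (zip xs ys) x"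
      by (auto simp: permutation_of_list_Cons)
  qed
  have "m \<in> set ss \<or> m \<in> set ts"
    using Cons.prems(4) by auto
  then show ?case
  proof
    assume "m \<in> set ss"
    then obtain ss' where ss: "ss = m # ss'"
      using hd[of ss] Cons.prems by auto
    have notin: "m \<notin> set ss'"
      using dist[OF Cons.prems(2)] ss by simp
    have "eps ix (set ts) m = 0"
    proof -
      have "{w \<in> set ts. ix w < ix m} = {}"
        using Cons.prems(4,5) ss m by (fastforce dest: less_asym)
      then show ?thesis by (simp add: eps_def)
    qed
    moreover have "sign (permutation_of_list (zip xs (ss' @ ts))) =
        (- 1) ^ inversions ix (set ss') (set ts)"
      using Cons.prems ss mxs notin by (intro Cons.IH) auto
    ultimately show ?thesis
      using notin by (simp add: ss fix_m inversions_def)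
  next
    assume "m \<in> set ts"
    then obtain ts' where ts: "ts = m # ts'"
      using hd[of ts] Cons.prems by auto
    have notin: "m \<notin> set ts'"
      using dist[OF Cons.prems(3)] ts by simp
    have disj: "m \<notin> set ss"
      using Cons.prems(5) ts by auto
    \<comment> \<open>Each entry of \<open>ss\<close> has exactly one extra inversion, with
      \<open>m\<close>; in total this matches the factor \<open>(- 1) ^ length ss\<close> from
      moving \<open>m\<close> to the front.\<close>
    have eps: "eps ix (set ts) s = Suc (eps ix (set ts') s)" if "s \<in> set ss" for s
    proof -
      have "ix m < ix s"
        using that Cons.prems(4) disj m by (metis UnCI set_ConsD)
      then have "{w \<in> set ts. ix w < ix s} = insert m {w \<in> set ts'. ix w < ix s}"
        by (auto simp: ts)
      then show ?thesis using notin by (simp add: eps_def)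
    qed
    have "sign (permutation_of_list (zip (m # xs) ([] @ ss @ m # ts'))) =
        (- 1) ^ length ss * sign (permutation_of_list (zip (m # xs) ([] @ m # ss @ ts')))"
      using Cons.prems(4,5) ts dist[OF Cons.prems(1)] dist[OF Cons.prems(2)] dist[OF Cons.prems(3)]
      by (intro sign_permutation_of_list_move) auto
    also have "sign (permutation_of_list (zip (m # xs) ([] @ m # ss @ ts'))) =
        sign (permutation_of_list (zip xs (ss @ ts')))"
      by (simp add: fix_m)
    also have "\<dots> = (- 1) ^ inversions ix (set ss) (set ts')"
      using Cons.prems ts mxs notin disj by (intro Cons.IH) auto
    finally show ?thesis
      using distinct_card[OF dist[OF Cons.prems(2)]]
      by (simp add: ts[symmetric] inversions_def eps sum.distrib power_add sum_Suc)
  qed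
qed

text \<open>The key is injective on \<open>A\<close> alone, so the sorting facts come from
  interpreting \<open>folding_insort_key\<close> with carrier \<open>A\<close>.\<close>

lemma (in linorder) sorted_key_list_of_set_inj_on:
  assumes "inj_on f A" "finite A"
  shows "set (sorted_key_list_of_set f A) = A"
    and "sorted_wrt (<) (map f (sorted_key_list_of_set f A))"
proof -
  interpret folding_insort_key "(\<le>)" "(<)" A f
    by standard (rule assms)
  show "set (sorted_key_list_of_set f A) = A"
    and "sorted_wrt (<) (map f (sorted_key_list_of_set f A))"
    using assms by simp_all
qed

text \<open>The identity of signs is integral. It passes to \<open>'k\<close>, where 1 and -1 may
  coincide, through the parity of the exponents.\<close>

lemma power_shuffle_parity:
  assumes "inj_on ix (\<sigma> \<union> \<tau>)" "finite \<sigma>" "finite \<tau>" "\<sigma> \<inter> \<tau> = {}"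
  shows "((- 1) ^ shuffle_parity ix \<sigma> \<tau> :: 'k::comm_ring_1) = (- 1) ^ inversions ix \<sigma> \<tau>"
proof -
  have "inj_on ix \<sigma>" "inj_on ix \<tau>"
    using assms(1) by (auto intro: inj_on_subset)
  then have "sign (shuffle_perm ix \<sigma> \<tau>) = (- 1) ^ inversions ix \<sigma> \<tau>"
    unfolding shuffle_perm_def using assms
    by (subst sign_permutation_of_list_shuffle[where ix = ix])
      (simp_all add: sorted_key_list_of_set_inj_on)
  then have "evenperm (shuffle_perm ix \<sigma> \<tau>) \<longleftrightarrow> even (inversions ix \<sigma> \<tau>)"
    by (cases "even (inversions ix \<sigma> \<tau>)") (auto simp: sign_def split: if_splits)
  then show ?thesis
    by (cases "even (inversions ix \<sigma> \<tau>)") (auto simp: shuffle_parity_def)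
qed

section \<open>The product and the differential on basis elements\<close>

lemma eps_remove:
  assumes "finite \<sigma>" "b \<in> \<sigma>"
  shows "eps ix \<sigma> a = eps ix (\<sigma> - {b}) a + (if ix b < ix a then 1 else 0)"
proof -
  have "eps ix \<sigma> a = eps ix (\<sigma> - {b} \<union> {b}) a"
    using assms by (simp add: insert_absorb)
  also have "\<dots> = eps ix (\<sigma> - {b}) a + eps ix {b} a"
    using assms by (intro eps_Un) auto
  also have "eps ix {b} a = (if ix b < ix a then 1 else 0)"
    by (auto simp: eps_def Collect_conv_if)
  finally show ?thesis .
qed

text \<open>Each element of \<sigma> lies either after \<open>z\<close> and is counted as an
  inversion, or before \<open>z\<close> and is counted by \<open>eps\<close>. This produces the sign
  \<open>(- 1) ^ card \<sigma>\<close> of the Leibniz rule.\<close>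

lemma inversions_singleton_right:
  assumes "inj_on ix (insert z \<sigma>)" "finite \<sigma>" "z \<notin> \<sigma>"
  shows "inversions ix \<sigma> {z} + eps ix \<sigma> z = card \<sigma>"
proof -
  have "eps ix {z} s = (if ix z < ix s then 1 else 0)" for s
    by (auto simp: eps_def Collect_conv_if)
  then have "inversions ix \<sigma> {z} = card {s \<in> \<sigma>. ix z < ix s}"
    using assms(2) by (simp add: inversions_def sum.If_cases Int_def)
  also have "\<dots> + eps ix \<sigma> z = card ({s \<in> \<sigma>. ix z < ix s} \<union> {s \<in> \<sigma>. ix s < ix z})"
    unfolding eps_def using assms(2) by (subst card_Un_disjoint) auto
  also have "{s \<in> \<sigma>. ix z < ix s} \<union> {s \<in> \<sigma>. ix s < ix z} = \<sigma>"
    using assms(1,3) by (auto simp: inj_on_def)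
  finally show ?thesis .
qed

text \<open>The terms at \<open>(a, b)\<close> and \<open>(b, a)\<close> cancel. Splitting the pairs
  by the order of their indices avoids dividing by 2, so 2-torsion is harmless.\<close>

lemma sum_antisymmetric_eq_0:
  fixes f :: "'a \<Rightarrow> 'a \<Rightarrow> 'b::ab_group_add" and ix :: "'a \<Rightarrow> nat"
  assumes "finite P" "sym P"
    and "\<And>a b. (a, b) \<in> P \<Longrightarrow> ix a \<noteq> ix b"
    and "\<And>a b. (a, b) \<in> P \<Longrightarrow> f b a = - f a b"
  shows "(\<Sum>(a, b)\<in>P. f a b) = 0"
proof -
  let ?L = "{(a, b) \<in> P. ix a < ix b}" and ?G = "{(a, b) \<in> P. ix b < ix a}"
  have "(\<Sum>(a, b)\<in>?G. f a b) = (\<Sum>(a, b)\<in>?L. f b a)"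
    by (rule sum.reindex_bij_witness[of _ prod.swap prod.swap])
      (use assms(2) in \<open>auto dest: symD\<close>)
  also have "\<dots> = (\<Sum>(a, b)\<in>?L. - f a b)"
    using assms(4) by (intro sum.cong) auto
  also have "\<dots> = - (\<Sum>(a, b)\<in>?L. f a b)"
    by (simp add: sum_negf case_prod_unfold)
  finally have "(\<Sum>(a, b)\<in>?L. f a b) + (\<Sum>(a, b)\<in>?G. f a b) = 0"
    by simp
  moreover have "P = ?L \<union> ?G"
    using assms(3) by (auto dest: linorder_neqE_nat)
  moreover have "finite ?L" "finite ?G" "?L \<inter> ?G = {}"
    using assms(1) by (auto intro: finite_subset)
  ultimately show ?thesis
    using sum.union_disjoint[of ?L ?G "\<lambda>(a, b). f a b"] by simp
qed

section \<open>The boundary of a basis element and its square\<close>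

definition boundary ::
  "('l::{finite,complete_lattice} \<Rightarrow> nat) \<Rightarrow> 'l set \<Rightarrow> ('l set \<Rightarrow>\<^sub>0 'k::comm_ring_1)" where
  "boundary ix \<sigma> = (\<Sum>z | z \<in> \<sigma> \<and> Sup (\<sigma> - {z}) = Sup \<sigma>.
     Poly_Mapping.single (\<sigma> - {z}) ((- 1) ^ eps ix \<sigma> z))"

definition basis_mult ::
  "('l::{finite,complete_lattice} \<Rightarrow> nat) \<Rightarrow> ('l \<Rightarrow> nat ^ 's) \<Rightarrow> 'l set \<Rightarrow> 'l set \<Rightarrow>
    ('l set \<Rightarrow>\<^sub>0 'k::comm_ring_1)" where
  "basis_mult ix rk \<sigma> \<tau> =
     (if rk (Sup (\<sigma> \<union> \<tau>)) \<noteq> rk (Sup \<sigma>) + rk (Sup \<tau>) then 0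
      else Poly_Mapping.single (\<sigma> \<union> \<tau>) ((- 1) ^ shuffle_parity ix \<sigma> \<tau>))"

lemma rel_atomic_diff_eq: "rel_atomic_diff ix = lin_extend (boundary ix)"
  by (simp add: rel_atomic_diff_def boundary_def[abs_def])

lemma rel_atomic_mult_eq:
  "rel_atomic_mult ix rk x y = lin_extend (\<lambda>\<sigma>. lin_extend (basis_mult ix rk \<sigma>) y) x"
  by (simp add: rel_atomic_mult_def basis_mult_def[abs_def])

lemma lin_extend_boundary:
  "lin_extend f (boundary ix \<sigma>) = (\<Sum>z | z \<in> \<sigma> \<and> Sup (\<sigma> - {z}) = Sup \<sigma>.
     free_scale ((- 1) ^ eps ix \<sigma> z) (f (\<sigma> - {z})))"
  by (simp add: boundary_def lin_extend_sum)

text \<open>Removing \<open>z\<close> and then \<open>w\<close> survives under a condition on the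
  join of \<open>\<sigma> - {z, w}\<close> that is symmetric in \<open>z\<close> and
  \<open>w\<close>. Removing the earlier atom first lowers the position of the later one by one, but
  not conversely, so the two orders have opposite signs.\<close>

lemma boundary_boundary:
  fixes ix :: "'l::{finite,complete_lattice} \<Rightarrow> nat"
  assumes "inj_on ix \<sigma>"
  shows "lin_extend (boundary ix) (boundary ix \<sigma>) = (0 :: 'l set \<Rightarrow>\<^sub>0 'k::comm_ring_1)"
proof -
  let ?A = "{z. z \<in> \<sigma> \<and> Sup (\<sigma> - {z}) = Sup \<sigma>}"
  let ?B = "\<lambda>z. {w. w \<in> \<sigma> - {z} \<and> Sup (\<sigma> - {z} - {w}) = Sup (\<sigma> - {z})}"
  let ?P = "{(z, w). z \<in> \<sigma> \<and> w \<in> \<sigma> \<and> z \<noteq> w \<and> Sup (\<sigma> - {z, w}) = Sup \<sigma>}"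
  let ?f = "\<lambda>z w. Poly_Mapping.single (\<sigma> - {z, w})
    ((- 1) ^ eps ix \<sigma> z * (- 1) ^ eps ix (\<sigma> - {z}) w :: 'k)"
  have free_scale_sum: "free_scale a (\<Sum>i\<in>I. g i) = (\<Sum>i\<in>I. free_scale a (g i))"
    for a :: 'k and I :: "'l set" and g :: "'l \<Rightarrow> ('l set \<Rightarrow>\<^sub>0 'k)"
    using module.scale_sum_right[OF module_free_scale] .
  have diff: "\<sigma> - {z} - {w} = \<sigma> - {z, w}" for z w
    by blast
  \<comment> \<open>The intermediate join is squeezed between the joins of
    \<open>\<sigma> - {z, w}\<close> and \<sigma>; hence two successive admissible removals amount
    to the single symmetric condition in \<open>?P\<close>.\<close>
  have Sup_diff: "Sup (\<sigma> - {z}) = Sup \<sigma>" if "Sup (\<sigma> - {z, w}) = Sup \<sigma>" for z w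
    using that Sup_subset_mono[of "\<sigma> - {z, w}" "\<sigma> - {z}"] Sup_subset_mono[of "\<sigma> - {z}" \<sigma>]
    by (metis Diff_mono Diff_subset antisym empty_subsetI insert_mono subset_refl)
  have "lin_extend (boundary ix) (boundary ix \<sigma>) = (\<Sum>z\<in>?A. \<Sum>w\<in>?B z. ?f z w)"
    unfolding lin_extend_boundary by (simp add: boundary_def free_scale_sum diff)
  also have "\<dots> = (\<Sum>(z, w)\<in>Sigma ?A ?B. ?f z w)"
    by (rule sum.Sigma) auto
  also have "Sigma ?A ?B = ?P"
  proof (intro set_eqI)
    fix p :: "'l \<times> 'l"
    obtain z w where "p = (z, w)" by fastforce
    then show "p \<in> Sigma ?A ?B \<longleftrightarrow> p \<in> ?P"
      using Sup_diff[of z w] by (auto simp: diff)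
  qed
  also have "(\<Sum>(z, w)\<in>?P. ?f z w) = 0"
  proof (rule sum_antisymmetric_eq_0)
    show "sym ?P"
      by (auto simp: sym_def insert_commute)
    show "ix z \<noteq> ix w" if "(z, w) \<in> ?P" for z w
      using that assms by (auto dest: inj_onD)
    show "?f w z = - ?f z w" if "(z, w) \<in> ?P" for z w
    proof -
      have "ix z \<noteq> ix w" "z \<in> \<sigma>" "w \<in> \<sigma>"
        using that assms by (auto dest: inj_onD)
      then show ?thesis
        by (cases "ix z < ix w")
          (auto simp: eps_remove[of \<sigma> w ix z] eps_remove[of \<sigma> z ix w] insert_commute
            single_uminus[symmetric] mult.commute)
    qed
  qed simp
  finally show ?thesis .
qed

section \<open>Pairs of sets on which the rank is additive\<close>

locale ranked_lattice =
  fixes ix :: "'l::{finite,complete_lattice} \<Rightarrow> nat" and rk :: "'l \<Rightarrow> nat ^ 's"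
  assumes inj_ix: "inj_on ix atoms"
    and strict_mono_rk: "strict_mono rk"
    and rk_bot: "rk bot = 0"
    and rk_submodular: "\<And>X Y. rk (sup X Y) + rk (inf X Y) \<le> rk X + rk Y"
begin

text \<open>The nonzero case of \<open>basis_mult\<close>. It depends on the two sets only through
  their joins, so it is stable under the removals that the boundary performs.\<close>

definition additive :: "'l set \<Rightarrow> 'l set \<Rightarrow> bool" where
  "additive \<sigma> \<tau> \<longleftrightarrow> rk (Sup (\<sigma> \<union> \<tau>)) = rk (Sup \<sigma>) + rk (Sup \<tau>)"

lemma additive_sym: "additive \<sigma> \<tau> \<longleftrightarrow> additive \<tau> \<sigma>"
  by (simp add: additive_def Un_commute add.commute)

text \<open>Submodularity with the nonnegative rank of the meet dropped, taken in one coordinate so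
  that linear arithmetic applies.\<close>

lemma rk_Sup_Un_le: "rk (Sup (\<sigma> \<union> \<tau>)) $ i \<le> rk (Sup \<sigma>) $ i + rk (Sup \<tau>) $ i"
proof -
  have "rk (sup (Sup \<sigma>) (Sup \<tau>)) $ i + rk (inf (Sup \<sigma>) (Sup \<tau>)) $ i
      \<le> rk (Sup \<sigma>) $ i + rk (Sup \<tau>) $ i"
    using rk_submodular[of "Sup \<sigma>" "Sup \<tau>"] by (simp add: less_eq_vec_def)
  then show ?thesis
    unfolding Sup_union_distrib by linarith
qed

text \<open>A common atom lies below the meet of the two joins. That meet then has positive rank in
  some coordinate, where submodularity makes the subadditive bound strict.\<close>

lemma additive_disjoint:
  assumes "additive \<sigma> \<tau>" "\<sigma> \<subseteq> atoms"
  shows "\<sigma> \<inter> \<tau> = {}"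
proof (rule ccontr)
  assume "\<sigma> \<inter> \<tau> \<noteq> {}"
  then obtain z where z: "z \<in> \<sigma>" "z \<in> \<tau>" by blast
  then have "bot < z" "z \<le> inf (Sup \<sigma>) (Sup \<tau>)"
    using assms(2) by (auto simp: atoms_def intro: Sup_upper)
  then have "rk bot < rk (inf (Sup \<sigma>) (Sup \<tau>))"
    using strict_mono_rk by (meson less_le_trans strict_monoD)
  then obtain i where "0 < rk (inf (Sup \<sigma>) (Sup \<tau>)) $ i"
    by (auto simp: rk_bot less_vec_def less_eq_vec_def)
  moreover have "rk (sup (Sup \<sigma>) (Sup \<tau>)) $ i + rk (inf (Sup \<sigma>) (Sup \<tau>)) $ i
      \<le> rk (Sup \<sigma>) $ i + rk (Sup \<tau>) $ i"
    using rk_submodular[of "Sup \<sigma>" "Sup \<tau>"] by (simp add: less_eq_vec_def)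
  ultimately show False
    using assms(1) by (simp add: additive_def Sup_union_distrib vec_eq_iff)
qed

text \<open>By subadditivity, a proper drop of the rank of \<open>\<Squnion>\<sigma>\<close> would show up in \<open>\<Squnion>(\<sigma> \<union> \<tau>)\<close>.\<close>

lemma additive_Sup_subset:
  assumes "additive \<sigma> \<tau>" "\<sigma>' \<subseteq> \<sigma>" "Sup (\<sigma>' \<union> \<tau>) = Sup (\<sigma> \<union> \<tau>)"
  shows "Sup \<sigma>' = Sup \<sigma>"
proof (rule ccontr)
  assume "Sup \<sigma>' \<noteq> Sup \<sigma>"
  then have "Sup \<sigma>' < Sup \<sigma>"
    using Sup_subset_mono[OF assms(2)] by simp
  then have "rk (Sup \<sigma>') < rk (Sup \<sigma>)"
    using strict_mono_rk by (rule strict_monoD[rotated])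
  moreover have "rk (Sup \<sigma>) $ i \<le> rk (Sup \<sigma>') $ i" for i
    using rk_Sup_Un_le[of \<sigma>' \<tau> i] assms(1,3) by (simp add: additive_def vec_eq_iff)
  ultimately show False
    by (simp add: less_vec_def less_eq_vec_def)
qed

lemma additive_cong: "Sup \<sigma>' = Sup \<sigma> \<Longrightarrow> additive \<sigma>' \<tau> \<longleftrightarrow> additive \<sigma> \<tau>"
  by (simp add: additive_def Sup_union_distrib)

lemma additive_cong_right: "Sup \<tau>' = Sup \<tau> \<Longrightarrow> additive \<sigma> \<tau>' \<longleftrightarrow> additive \<sigma> \<tau>"
  by (simp add: additive_def Sup_union_distrib)

text \<open>In each coordinate, either bracketing bounds the rank of the triple join by the same sum
  of three ranks; attaining that bound forces equality at every stage of both.\<close>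

lemma additive_assoc:
  "additive \<sigma> \<tau> \<and> additive (\<sigma> \<union> \<tau>) \<rho> \<longleftrightarrow> additive \<tau> \<rho> \<and> additive \<sigma> (\<tau> \<union> \<rho>)"
proof -
  have "rk (Sup (\<sigma> \<union> \<tau>)) $ i = rk (Sup \<sigma>) $ i + rk (Sup \<tau>) $ i \<and>
      rk (Sup (\<sigma> \<union> \<tau> \<union> \<rho>)) $ i = rk (Sup (\<sigma> \<union> \<tau>)) $ i + rk (Sup \<rho>) $ i \<longleftrightarrow>
      rk (Sup (\<tau> \<union> \<rho>)) $ i = rk (Sup \<tau>) $ i + rk (Sup \<rho>) $ i \<and>
      rk (Sup (\<sigma> \<union> \<tau> \<union> \<rho>)) $ i = rk (Sup \<sigma>) $ i + rk (Sup (\<tau> \<union> \<rho>)) $ i" for i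
    using rk_Sup_Un_le[of \<sigma> \<tau> i] rk_Sup_Un_le[of "\<sigma> \<union> \<tau>" \<rho> i] rk_Sup_Un_le[of \<tau> \<rho> i]
      rk_Sup_Un_le[of \<sigma> "\<tau> \<union> \<rho>" i]
    unfolding Un_assoc by linarith
  then show ?thesis
    by (simp add: additive_def vec_eq_iff Un_assoc flip: all_conj_distrib)
qed

section \<open>Associativity and the Leibniz rule on basis elements\<close>

lemma basis_mult_not_additive: "\<not> additive \<sigma> \<tau> \<Longrightarrow> basis_mult ix rk \<sigma> \<tau> = 0"
  by (simp add: basis_mult_def additive_def)

lemma basis_mult_additive:
  assumes "additive \<sigma> \<tau>" "\<sigma> \<subseteq> atoms" "\<tau> \<subseteq> atoms"
  shows "basis_mult ix rk \<sigma> \<tau> =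
    (Poly_Mapping.single (\<sigma> \<union> \<tau>) ((- 1) ^ inversions ix \<sigma> \<tau>) :: 'l set \<Rightarrow>\<^sub>0 'k::comm_ring_1)"
proof -
  have "inj_on ix (\<sigma> \<union> \<tau>)"
    using inj_ix assms(2,3) by (auto intro: inj_on_subset)
  then show ?thesis
    using assms additive_disjoint[OF assms(1,2)]
    by (simp add: basis_mult_def additive_def power_shuffle_parity)
qed

text \<open>When the rank conditions hold, both signs count the inversions between the three pairs
  of sets; otherwise both bracketings vanish together by \<open>additive_assoc\<close>.\<close>

lemma basis_mult_assoc:
  fixes \<sigma> \<tau> \<rho> :: "'l set"
  assumes "\<sigma> \<subseteq> atoms" "\<tau> \<subseteq> atoms" "\<rho> \<subseteq> atoms"
  shows "lin_extend (\<lambda>\<upsilon>. basis_mult ix rk \<upsilon> \<rho>) (basis_mult ix rk \<sigma> \<tau>) =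
    (lin_extend (basis_mult ix rk \<sigma>) (basis_mult ix rk \<tau> \<rho>) :: 'l set \<Rightarrow>\<^sub>0 'k::comm_ring_1)"
proof (cases "additive \<sigma> \<tau> \<and> additive (\<sigma> \<union> \<tau>) \<rho>")
  case True
  then have add: "additive \<sigma> \<tau>" "additive (\<sigma> \<union> \<tau>) \<rho>" "additive \<tau> \<rho>" "additive \<sigma> (\<tau> \<union> \<rho>)"
    using additive_assoc by blast+
  have "\<sigma> \<inter> \<tau> = {}" "\<tau> \<inter> \<rho> = {}"
    using add assms additive_disjoint by blast+
  then show ?thesis
    using add assms
    by (simp add: basis_mult_additive inversions_Un_left inversions_Un_right Un_assoc
      flip: power_add) (simp add: add_ac)
next
  case False
  then have "\<not> (additive \<tau> \<rho> \<and> additive \<sigma> (\<tau> \<union> \<rho>))"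
    using additive_assoc by blast
  then have "lin_extend (basis_mult ix rk \<sigma>) (basis_mult ix rk \<tau> \<rho>) = (0 :: 'l set \<Rightarrow>\<^sub>0 'k)"
    using assms
    by (cases "additive \<tau> \<rho>") (simp_all add: basis_mult_not_additive basis_mult_additive)
  moreover have
    "lin_extend (\<lambda>\<upsilon>. basis_mult ix rk \<upsilon> \<rho>) (basis_mult ix rk \<sigma> \<tau>) = (0 :: 'l set \<Rightarrow>\<^sub>0 'k)"
    using assms False
    by (cases "additive \<sigma> \<tau>") (simp_all add: basis_mult_not_additive basis_mult_additive)
  ultimately show ?thesis by simp
qed

lemma basis_leibniz:
  fixes \<sigma> \<tau> :: "'l set"
  assumes "\<sigma> \<subseteq> atoms" "\<tau> \<subseteq> atoms"
  shows "lin_extend (boundary ix) (basis_mult ix rk \<sigma> \<tau>) =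
    (lin_extend (\<lambda>\<upsilon>. basis_mult ix rk \<upsilon> \<tau>) (boundary ix \<sigma>) +
     free_scale ((- 1) ^ card \<sigma>) (lin_extend (basis_mult ix rk \<sigma>) (boundary ix \<tau>))
     :: 'l set \<Rightarrow>\<^sub>0 'k::comm_ring_1)"
proof (cases "additive \<sigma> \<tau>")
  case False
  \<comment> \<open>Boundary terms keep the join, so they inherit the failure of additivity and all
    products vanish.\<close>
  have "basis_mult ix rk (\<sigma> - {z}) \<tau> = (0 :: 'l set \<Rightarrow>\<^sub>0 'k)" if "Sup (\<sigma> - {z}) = Sup \<sigma>" for z
    using False that additive_cong basis_mult_not_additive by blast
  moreover have "basis_mult ix rk \<sigma> (\<tau> - {z}) = (0 :: 'l set \<Rightarrow>\<^sub>0 'k)"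
    if "Sup (\<tau> - {z}) = Sup \<tau>" for z
    using False that additive_cong_right basis_mult_not_additive by blast
  ultimately show ?thesis
    using False by (simp add: lin_extend_boundary basis_mult_not_additive)
next
  case True
  let ?S = "{z. z \<in> \<sigma> \<and> Sup (\<sigma> - {z}) = Sup \<sigma>}"
  let ?T = "{z. z \<in> \<tau> \<and> Sup (\<tau> - {z}) = Sup \<tau>}"
  let ?f = "\<lambda>z. Poly_Mapping.single (\<sigma> \<union> \<tau> - {z})
    ((- 1) ^ inversions ix \<sigma> \<tau> * (- 1) ^ eps ix (\<sigma> \<union> \<tau>) z :: 'k)"
  have disj: "\<sigma> \<inter> \<tau> = {}"
    using additive_disjoint True assms by blast
  have diff_left: "\<sigma> \<union> \<tau> - {z} = (\<sigma> - {z}) \<union> \<tau>" if "z \<in> \<sigma>" for z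
    using that disj by blast
  have diff_right: "\<sigma> \<union> \<tau> - {z} = \<sigma> \<union> (\<tau> - {z})" if "z \<in> \<tau>" for z
    using that disj by blast
  \<comment> \<open>The join of a union depends only on the two joins, which gives one direction;
    the other is \<open>additive_Sup_subset\<close>.\<close>
  have S: "Sup (\<sigma> \<union> \<tau> - {z}) = Sup (\<sigma> \<union> \<tau>) \<longleftrightarrow> Sup (\<sigma> - {z}) = Sup \<sigma>" if "z \<in> \<sigma>" for z
    unfolding diff_left[OF that] using additive_Sup_subset[OF True, of "\<sigma> - {z}"]
    by (auto simp: Sup_union_distrib)
  have T: "Sup (\<sigma> \<union> \<tau> - {z}) = Sup (\<sigma> \<union> \<tau>) \<longleftrightarrow> Sup (\<tau> - {z}) = Sup \<tau>" if "z \<in> \<tau>" for z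
    unfolding diff_right[OF that]
    using additive_Sup_subset[OF True[unfolded additive_sym[of \<sigma>]], of "\<tau> - {z}"]
    by (auto simp: Sup_union_distrib sup_commute)
  have "{z. z \<in> \<sigma> \<union> \<tau> \<and> Sup (\<sigma> \<union> \<tau> - {z}) = Sup (\<sigma> \<union> \<tau>)} = ?S \<union> ?T"
    using S T by blast
  then have "lin_extend (boundary ix) (basis_mult ix rk \<sigma> \<tau>) = (\<Sum>z\<in>?S \<union> ?T. ?f z)"
    using True assms
    by (simp add: basis_mult_additive boundary_def
      module.scale_sum_right[OF module_free_scale])
  also have "\<dots> = sum ?f ?S + sum ?f ?T"
    using disj by (intro sum.union_disjoint) auto
  also have "sum ?f ?S = lin_extend (\<lambda>\<upsilon>. basis_mult ix rk \<upsilon> \<tau>) (boundary ix \<sigma>)"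
    unfolding lin_extend_boundary
  proof (rule sum.cong)
    fix z assume z: "z \<in> ?S"
    \<comment> \<open>Removing \<open>z\<close> from \<sigma> loses \<open>eps ix \<tau> z\<close>
      inversions, and the position of \<open>z\<close> in the union exceeds that in \<sigma> by the
      same number; the two signs cancel.\<close>
    have "inversions ix \<sigma> \<tau> = eps ix \<tau> z + inversions ix (\<sigma> - {z}) \<tau>"
      unfolding inversions_def using z by (intro sum.remove) auto
    moreover have "additive (\<sigma> - {z}) \<tau>"
      using z True additive_cong by blast
    moreover have "eps ix (\<sigma> \<union> \<tau>) z = eps ix \<sigma> z + eps ix \<tau> z"
      using disj by (simp add: eps_Un)
    moreover have "(- 1) ^ eps ix \<tau> z * (- 1) ^ eps ix \<tau> z = (1 :: 'k)"
      by (simp flip: power_mult_distrib)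
    then have "(- 1) ^ eps ix \<tau> z * ((- 1) ^ eps ix \<tau> z * a) = a" for a :: 'k
      by (simp flip: mult.assoc)
    ultimately show "?f z = free_scale ((- 1) ^ eps ix \<sigma> z) (basis_mult ix rk (\<sigma> - {z}) \<tau>)"
      using assms z
      by (subst basis_mult_additive) (auto simp: diff_left power_add mult_ac)
  qed simp
  also have "sum ?f ?T =
      free_scale ((- 1) ^ card \<sigma>) (lin_extend (basis_mult ix rk \<sigma>) (boundary ix \<tau>))"
    unfolding lin_extend_boundary module.scale_sum_right[OF module_free_scale]
  proof (rule sum.cong)
    fix z assume z: "z \<in> ?T"
    \<comment> \<open>Here the inversions lost with \<open>z\<close> and the elements of \<sigma>
      before \<open>z\<close> together exhaust \<sigma>, which leaves the factor
      \<open>(- 1) ^ card \<sigma>\<close>.\<close>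
    have "inversions ix \<sigma> (\<tau> - {z} \<union> {z}) = inversions ix \<sigma> (\<tau> - {z}) + inversions ix \<sigma> {z}"
      by (rule inversions_Un_right) auto
    moreover have "\<tau> - {z} \<union> {z} = \<tau>"
      using z by blast
    moreover have "inversions ix \<sigma> {z} + eps ix \<sigma> z = card \<sigma>"
      using z assms disj
      by (intro inversions_singleton_right inj_on_subset[OF inj_ix]) auto
    moreover have "eps ix (\<sigma> \<union> \<tau>) z = eps ix \<sigma> z + eps ix \<tau> z"
      using disj by (simp add: eps_Un)
    ultimately have sgn: "inversions ix \<sigma> \<tau> + eps ix (\<sigma> \<union> \<tau>) z =
        card \<sigma> + (eps ix \<tau> z + inversions ix \<sigma> (\<tau> - {z}))"
      by simp
    have "additive \<sigma> (\<tau> - {z})"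
      using z True additive_cong_right by blast
    then show "?f z = free_scale ((- 1) ^ card \<sigma>)
        (free_scale ((- 1) ^ eps ix \<tau> z) (basis_mult ix rk \<sigma> (\<tau> - {z})))"
      using assms z
      by (subst basis_mult_additive) (auto simp: diff_right sgn simp flip: power_add)
  qed simp
  finally show ?thesis .
qed

end

section \<open>The differential graded algebra\<close>

lemma subspace_keys: "module.subspace free_scale {x. \<forall>b\<in>Poly_Mapping.keys x. P b}"
  by (intro module.subspaceI[OF module_free_scale])
    (auto dest!: Poly_Mapping.keys_add[THEN subsetD] keys_free_scale[THEN subsetD])

text \<open>Only the summand of degree \<open>deg b\<close> can have \<open>b\<close> in its
  support. This serves both existence and uniqueness of the decomposition.\<close>

lemma lookup_sum_graded:
  fixes f :: "nat \<Rightarrow> ('b \<Rightarrow>\<^sub>0 'k::comm_ring_1)"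
  assumes "finite {p. f p \<noteq> 0}" "\<And>p b. b \<in> Poly_Mapping.keys (f p) \<Longrightarrow> deg b = p"
  shows "Poly_Mapping.lookup (\<Sum>p | f p \<noteq> 0. f p) b = Poly_Mapping.lookup (f (deg b)) b"
proof -
  have zero: "Poly_Mapping.lookup (f p) b = 0" if "p \<noteq> deg b" for p
    using assms(2)[of b p] that by (auto simp: in_keys_iff)
  show ?thesis
  proof (cases "f (deg b) = 0")
    case True
    then show ?thesis
      unfolding lookup_sum by (intro trans[OF sum.neutral]) (auto intro!: zero)
  next
    case False
    then show ?thesis
      unfolding lookup_sum using zero assms(1)
      by (subst sum.remove[of _ "deg b"]) (auto intro!: sum.neutral)
  qed
qed

lemma direct_sum_keys:
  fixes x :: "'b \<Rightarrow>\<^sub>0 'k::comm_ring_1" and deg :: "'b \<Rightarrow> nat"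
  assumes "\<forall>b\<in>Poly_Mapping.keys x. P b"
  shows "\<exists>!f. (\<forall>p. f p \<in> {x. \<forall>b\<in>Poly_Mapping.keys x. P b \<and> deg b = p}) \<and>
    finite {p. f p \<noteq> 0} \<and> x = (\<Sum>p | f p \<noteq> 0. f p)"
proof (rule ex1I, intro conjI)
  \<comment> \<open>The component of degree \<open>p\<close> restricts \<open>x\<close> to the basis
    elements of that degree; as a linear extension it has finite support automatically.\<close>
  let ?f = "\<lambda>p. lin_extend (\<lambda>b. if deg b = p then Poly_Mapping.single b 1 else 0) x"
  have lookup: "Poly_Mapping.lookup (?f p) b = (if deg b = p then Poly_Mapping.lookup x b else 0)"
    for p b
  proof -
    \<comment> \<open>Inserting \<open>b\<close> covers the case where it is outside the support of
      \<open>x\<close>.\<close>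
    have "Poly_Mapping.lookup (?f p) b =
        (\<Sum>c\<in>insert b (Poly_Mapping.keys x). Poly_Mapping.lookup x c *
          Poly_Mapping.lookup (if deg c = p then Poly_Mapping.single c 1 else 0) b)"
      by (rule lookup_lin_extend) auto
    also have "\<dots> = (\<Sum>c\<in>insert b (Poly_Mapping.keys x).
        if c = b then if deg b = p then Poly_Mapping.lookup x b else 0 else 0)"
      by (rule sum.cong) (auto simp: lookup_single)
    finally show ?thesis by (simp add: sum.delta)
  qed
  show mem: "\<forall>p. ?f p \<in> {x. \<forall>b\<in>Poly_Mapping.keys x. P b \<and> deg b = p}"
    using assms by (auto simp: in_keys_iff lookup split: if_splits)
  have "{p. ?f p \<noteq> 0} \<subseteq> deg ` Poly_Mapping.keys x"
    by (auto simp: poly_mapping_eq_iff fun_eq_iff lookup in_keys_iff split: if_splits)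
  then show fin: "finite {p. ?f p \<noteq> 0}"
    by (rule finite_subset) simp
  show "x = (\<Sum>p | ?f p \<noteq> 0. ?f p)"
  proof (rule poly_mapping_eqI)
    fix b
    have "Poly_Mapping.lookup (\<Sum>p | ?f p \<noteq> 0. ?f p) b = Poly_Mapping.lookup (?f (deg b)) b"
      using mem by (intro lookup_sum_graded[OF fin]) blast
    then show "Poly_Mapping.lookup x b = Poly_Mapping.lookup (\<Sum>p | ?f p \<noteq> 0. ?f p) b"
      unfolding lookup by simp
  qed
  fix g
  assume g: "(\<forall>p. g p \<in> {x. \<forall>b\<in>Poly_Mapping.keys x. P b \<and> deg b = p}) \<and>
    finite {p. g p \<noteq> 0} \<and> x = (\<Sum>p | g p \<noteq> 0. g p)"
  show "g = ?f"
  proof (intro ext poly_mapping_eqI)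
    fix p b
    \<comment> \<open>Uniqueness: the coefficients of any decomposition \<open>g\<close> in matching
      degree are read off from \<open>x\<close>, and all others vanish.\<close>
    have "Poly_Mapping.lookup x b = Poly_Mapping.lookup (g (deg b)) b"
    proof -
      have "Poly_Mapping.lookup (\<Sum>p | g p \<noteq> 0. g p) b = Poly_Mapping.lookup (g (deg b)) b"
        using g by (intro lookup_sum_graded) auto
      then show ?thesis
        using g by metis
    qed
    moreover have "Poly_Mapping.lookup (g p) b = 0" if "deg b \<noteq> p"
    proof -
      have "b \<notin> Poly_Mapping.keys (g p)"
        using g that by blast
      then show ?thesis by (simp add: in_keys_iff)
    qed
    ultimately show "Poly_Mapping.lookup (g p) b = Poly_Mapping.lookup (?f p) b"
      unfolding lookup by auto
  qed
qed

lemma keys_boundary: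
  assumes "c \<in> Poly_Mapping.keys (boundary ix \<sigma> :: 'l::{finite,complete_lattice} set \<Rightarrow>\<^sub>0 'k::comm_ring_1)"
  shows "\<exists>z\<in>\<sigma>. c = \<sigma> - {z}"
proof -
  have "(\<Sum>z | z \<in> \<sigma> \<and> Sup (\<sigma> - {z}) = Sup \<sigma>. Poly_Mapping.lookup
      (Poly_Mapping.single (\<sigma> - {z}) ((- 1) ^ eps ix \<sigma> z)) c) \<noteq> (0 :: 'k)"
    using assms by (simp add: in_keys_iff boundary_def lookup_sum)
  then obtain z where "z \<in> \<sigma>"
    and "Poly_Mapping.lookup (Poly_Mapping.single (\<sigma> - {z}) ((- 1) ^ eps ix \<sigma> z)) c \<noteq> (0 :: 'k)"
    by (auto dest: sum.not_neutral_contains_not_neutral)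
  then show ?thesis
    by (metis lookup_single_not_eq)
qed

section \<open>From basis elements to arbitrary chains\<close>

context ranked_lattice
begin

text \<open>Disjointness is recorded because it makes cardinalities add, which gives the degree of a
  product.\<close>

lemma keys_basis_mult:
  assumes "c \<in> Poly_Mapping.keys (basis_mult ix rk \<sigma> \<tau>)" "\<sigma> \<subseteq> atoms"
  shows "c = \<sigma> \<union> \<tau> \<and> \<sigma> \<inter> \<tau> = {}"
proof -
  have "additive \<sigma> \<tau>"
    by (rule ccontr) (use assms(1) in \<open>simp add: basis_mult_not_additive\<close>)
  then show ?thesis
    using assms additive_disjoint[of \<sigma> \<tau>]
    by (simp add: basis_mult_def additive_def split: if_splits)
qed

theorem differential_graded_algebra_rel_atomic:
  "differential_graded_algebra
    (free_scale :: 'k::comm_ring_1 \<Rightarrow> ('l set \<Rightarrow>\<^sub>0 'k) \<Rightarrow> ('l set \<Rightarrow>\<^sub>0 'k))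
    rel_atomic rel_atomic_part (rel_atomic_diff ix) (rel_atomic_mult ix rk)"
proof (intro differential_graded_algebra.intro module_free_scale
    differential_graded_algebra_axioms.intro)
  fix x y z :: "'l set \<Rightarrow>\<^sub>0 'k" and p q :: nat and a :: 'k
  show "module.subspace free_scale (rel_atomic :: ('l set \<Rightarrow>\<^sub>0 'k) set)"
    unfolding rel_atomic_def by (rule subspace_keys)
  show "module.subspace free_scale (rel_atomic_part p :: ('l set \<Rightarrow>\<^sub>0 'k) set)"
    unfolding rel_atomic_part_def by (rule subspace_keys)
  show "rel_atomic_part p \<subseteq> (rel_atomic :: ('l set \<Rightarrow>\<^sub>0 'k) set)"
    by (auto simp: rel_atomic_def rel_atomic_part_def)
  show "\<exists>!f. (\<forall>p. f p \<in> rel_atomic_part p) \<and> finite {p. f p \<noteq> 0} \<and> x = (\<Sum>p | f p \<noteq> 0. f p)"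
    if "x \<in> rel_atomic"
    using that unfolding rel_atomic_def rel_atomic_part_def
    by (intro direct_sum_keys) simp
  show "rel_atomic_diff ix (x + y) = rel_atomic_diff ix x + rel_atomic_diff ix y"
    by (simp add: rel_atomic_diff_eq lin_extend_add)
  show "rel_atomic_diff ix (free_scale a x) = free_scale a (rel_atomic_diff ix x)"
    by (simp add: rel_atomic_diff_eq lin_extend_scale)
  show "rel_atomic_diff ix x = 0" if "x \<in> rel_atomic_part 0"
  proof -
    \<comment> \<open>In a finite lattice a set of cardinality 0 is empty, so its boundary is an
      empty sum.\<close>
    have "boundary ix \<sigma> = (0 :: 'l set \<Rightarrow>\<^sub>0 'k)" if "\<sigma> \<in> Poly_Mapping.keys x" for \<sigma>
      using that \<open>x \<in> rel_atomic_part 0\<close> by (auto simp: rel_atomic_part_def boundary_def)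
    then show ?thesis
      unfolding rel_atomic_diff_eq using lin_extend_cong[of x "boundary ix" "\<lambda>_. 0"] by simp
  qed
  show "rel_atomic_diff ix x \<in> rel_atomic_part p" if "x \<in> rel_atomic_part (Suc p)"
    using that unfolding rel_atomic_diff_eq rel_atomic_part_def
    by (fastforce dest!: keys_lin_extend keys_boundary)
  show "rel_atomic_diff ix (rel_atomic_diff ix x) = 0" if "x \<in> rel_atomic"
  proof -
    have "lin_extend (boundary ix) (boundary ix \<sigma>) = (0 :: 'l set \<Rightarrow>\<^sub>0 'k)"
      if "\<sigma> \<in> Poly_Mapping.keys x" for \<sigma>
      using that \<open>x \<in> rel_atomic\<close> inj_on_subset[OF inj_ix]
      by (intro boundary_boundary) (auto simp: rel_atomic_def)
    then show ?thesis
      unfolding rel_atomic_diff_eq lin_extend_comp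
      using lin_extend_cong[of x "\<lambda>\<sigma>. lin_extend (boundary ix) (boundary ix \<sigma>)" "\<lambda>_. 0"] by simp
  qed
  show "rel_atomic_mult ix rk (x + y) z = rel_atomic_mult ix rk x z + rel_atomic_mult ix rk y z"
    by (simp add: rel_atomic_mult_eq lin_extend_add)
  show "rel_atomic_mult ix rk x (y + z) = rel_atomic_mult ix rk x y + rel_atomic_mult ix rk x z"
    by (simp add: rel_atomic_mult_eq lin_extend_add lin_extend_add_fun)
  show "rel_atomic_mult ix rk (free_scale a x) y = free_scale a (rel_atomic_mult ix rk x y)"
    by (simp add: rel_atomic_mult_eq lin_extend_scale)
  show "rel_atomic_mult ix rk x (free_scale a y) = free_scale a (rel_atomic_mult ix rk x y)"
    by (simp add: rel_atomic_mult_eq lin_extend_scale lin_extend_scale_fun)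
  show "rel_atomic_mult ix rk x y \<in> rel_atomic_part (p + q)"
    if "x \<in> rel_atomic_part p" "y \<in> rel_atomic_part q"
    using that unfolding rel_atomic_mult_eq rel_atomic_part_def
    by (auto dest!: keys_lin_extend keys_basis_mult simp: card_Un_disjoint)
  show "rel_atomic_mult ix rk (rel_atomic_mult ix rk x y) z =
      rel_atomic_mult ix rk x (rel_atomic_mult ix rk y z)"
    if "x \<in> rel_atomic" "y \<in> rel_atomic" "z \<in> rel_atomic"
  proof -
    have "rel_atomic_mult ix rk (rel_atomic_mult ix rk x y) z =
        lin_extend (\<lambda>\<sigma>. lin_extend (\<lambda>\<tau>. lin_extend (\<lambda>\<rho>.
          lin_extend (\<lambda>\<upsilon>. basis_mult ix rk \<upsilon> \<rho>) (basis_mult ix rk \<sigma> \<tau>)) z) y) x"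
      unfolding rel_atomic_mult_eq lin_extend_comp
      \<comment> \<open>The expansion of the product of \<sigma> and \<tau> is interchanged with the
        extension over \<open>z\<close>, so that \<rho> is fixed before the inner product is
        evaluated.\<close>
      by (subst lin_extend_swap) simp
    also have "\<dots> = lin_extend (\<lambda>\<sigma>. lin_extend (\<lambda>\<tau>. lin_extend (\<lambda>\<rho>.
          lin_extend (basis_mult ix rk \<sigma>) (basis_mult ix rk \<tau> \<rho>)) z) y) x"
      using that by (intro lin_extend_cong basis_mult_assoc) (auto simp: rel_atomic_def)
    also have "\<dots> = rel_atomic_mult ix rk x (rel_atomic_mult ix rk y z)"
      unfolding rel_atomic_mult_eq lin_extend_comp ..
    finally show ?thesis .
  qed
  show "rel_atomic_diff ix (rel_atomic_mult ix rk x y) =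
      rel_atomic_mult ix rk (rel_atomic_diff ix x) y +
      free_scale ((- 1) ^ p) (rel_atomic_mult ix rk x (rel_atomic_diff ix y))"
    if "x \<in> rel_atomic_part p" "y \<in> rel_atomic"
  proof -
    have "rel_atomic_diff ix (rel_atomic_mult ix rk x y) =
        lin_extend (\<lambda>\<sigma>. lin_extend (\<lambda>\<tau>.
          lin_extend (boundary ix) (basis_mult ix rk \<sigma> \<tau>)) y) x"
      by (simp add: rel_atomic_diff_eq rel_atomic_mult_eq lin_extend_comp)
    \<comment> \<open>Every \<sigma> in the support of \<open>x\<close> has cardinality
      \<open>p\<close>, so the sign in \<open>basis_leibniz\<close> is constant and can be pulled
      out next.\<close>
    also have "\<dots> = lin_extend (\<lambda>\<sigma>. lin_extend (\<lambda>\<tau>.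
        lin_extend (\<lambda>\<upsilon>. basis_mult ix rk \<upsilon> \<tau>) (boundary ix \<sigma>) +
        free_scale ((- 1) ^ p) (lin_extend (basis_mult ix rk \<sigma>) (boundary ix \<tau>))) y) x"
      using that
      by (intro lin_extend_cong) (auto simp: rel_atomic_def rel_atomic_part_def basis_leibniz)
    also have "\<dots> =
        lin_extend (\<lambda>\<sigma>. lin_extend (\<lambda>\<tau>. lin_extend (\<lambda>\<upsilon>. basis_mult ix rk \<upsilon> \<tau>) (boundary ix \<sigma>)) y) x +
        free_scale ((- 1) ^ p)
          (lin_extend (\<lambda>\<sigma>. lin_extend (\<lambda>\<tau>. lin_extend (basis_mult ix rk \<sigma>) (boundary ix \<tau>)) y) x)"
      by (simp add: lin_extend_add_fun lin_extend_scale_fun)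
    also have "\<dots> = rel_atomic_mult ix rk (rel_atomic_diff ix x) y +
        free_scale ((- 1) ^ p) (rel_atomic_mult ix rk x (rel_atomic_diff ix y))"
      unfolding rel_atomic_mult_eq rel_atomic_diff_eq lin_extend_comp
      by (subst lin_extend_swap) simp
    finally show ?thesis .
  qed
qed

end

theorem proposition3p1:
  fixes ix :: "'l::{finite,complete_lattice} \<Rightarrow> nat"
    and rk :: "'l \<Rightarrow> nat ^ 's"
  assumes "inj_on ix atoms"
    and "strict_mono rk"
    and "rk bot = 0"
    and "\<And>X Y. rk (sup X Y) + rk (inf X Y) \<le> rk X + rk Y"
  shows "differential_graded_algebra
    (free_scale :: 'k::comm_ring_1 \<Rightarrow> ('l set \<Rightarrow>\<^sub>0 'k) \<Rightarrow> ('l set \<Rightarrow>\<^sub>0 'k))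
    rel_atomic rel_atomic_part (rel_atomic_diff ix) (rel_atomic_mult ix rk)"
  using assms
  by (intro ranked_lattice.differential_graded_algebra_rel_atomic ranked_lattice.intro)

end
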